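(* Let $(\mathcal X,m)$ be a metric space, $\mu$ a finite positive Borel measure supported on $\mathcal X$, and $X_N=\{x_1,\dots,x_N\}$ a set of $N$ points independently and randomly distributed over $\mathcal X$ with respect to $\mu$. Let $\Phi$ be a continuous non-negative strictly increasing function on $(0,\infty)$ satisfying $\Phi(r)\to0$ as $r\to0^+$ and the strict doubling property; i.e., for some constants $C_1,C_2>1$ and any small $r>0$ it holds that $C_1\Phi(r)\leq\Phi(2r)\leq C_2\Phi(r)$. Suppose there exists a subset $\mathcal X_1\subset\mathcal X$ with the following two properties: (i) $\mu(\mathcal X_1)>0$; (ii) there exist positive numbers $r_0$ and $c$ such that for any $x\in\mathcal X_1$ and every $0<r<r_0$ the regularity condition $c\,\Phi(r)\leq\mu(B(x,r))\leq\Phi(r)$ holds. Then there exist positive constants $c_1,c_2,c_3$ (not depending on $N$) such that $$\mathbb P\left[\rho(X_N,\mathcal X)\geq c_1\Phi^{-1}\left(\frac{c_2\log N-c_3\log\log N}{N}\right)\right]=1-o(1),\qquad N\to\infty.$$ Consequently, there exist positive constants $c_1$ and $c_2$ (not depending on $N$) such that for all sufficiently large $N$ $$\mathbb E\rho(X_N,\mathcal X)\geq c_1\Phi^{-1}\left(c_2\frac{\log N}{N}\right).$$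
   Context: $B(x,r)=\{y\in\mathcal X: m(y,x)\le r\}$ denotes the closed ball. The covering radius of $X_N$ with respect to $\mathcal X$ is $\rho(X_N,\mathcal X):=\sup_{y\in\mathcal X}\inf_{j} m(y,x_j)$. A point is randomly distributed over $\mathcal X$ with respect to $\mu$ if its law is the probability measure $\mu/\mu(\mathcal X)$. $\mathbb P$ and $\mathbb E$ denote probability and expectation with respect to the random choice of $X_N$. $\Phi^{-1}$ is the inverse of $\Phi$, defined on the range of $\Phi$. The set $\mathcal X_1$ is $\mu$-measurable. *)

theory Defs
  imports "HOL-Probability.Probability"
begin

text \<open>The value may be infinite when the space is unbounded, hence the type \<^typ>\<open>ennreal\<close>.\<close>

definition covering_radius :: "'a::metric_space set \<Rightarrow> 'a set \<Rightarrow> ennreal" where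
  "covering_radius A X = (SUP y\<in>X. INF x\<in>A. ennreal (dist y x))"

definition normalized :: "'a measure \<Rightarrow> 'a measure" where
  "normalized \<mu> = scale_measure (1 / emeasure \<mu> (space \<mu>)) \<mu>"

text \<open>The joint law of \<open>N\<close> independent points \<open>\<omega> 1, \<dots>, \<omega> N\<close>, each with law
  \<open>\<mu> / \<mu>(X)\<close>.\<close>

definition random_points :: "'a measure \<Rightarrow> nat \<Rightarrow> (nat \<Rightarrow> 'a) measure" where
  "random_points \<mu> N = PiM {1..N} (\<lambda>_. normalized \<mu>)"

text \<open>On a non-separable space the covering radius is a supremum over an uncountable set and need
  not be measurable for the product \<open>\<sigma>\<close>-algebra, and \<^const>\<open>measure\<close> is \<open>0\<close> by convention on
  non-measurable sets. The inner probability is the probability whenever the latter is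
  meaningful (see \<open>inner_prob_eq_measure\<close>). Likewise \<^const>\<open>nn_integral\<close> is by definition the
  supremum over the simple functions below the integrand, that is, the expectation for a
  measurable integrand and the lower integral otherwise.\<close>

definition inner_prob :: "'a measure \<Rightarrow> 'a set \<Rightarrow> real" where
  "inner_prob M A = (SUP E\<in>{E \<in> sets M. E \<subseteq> A}. measure M E)"

lemma inner_prob_eq_measure:
  assumes "finite_measure M" "A \<in> sets M"
  shows "inner_prob M A = measure M A"
  unfolding inner_prob_def
  by (rule cSup_eq_maximum) (use assms in \<open>auto intro: finite_measure.finite_measure_mono\<close>)

end

theory Submission
  imports Defs "HOL-Real_Asymp.Real_Asymp"
begin

text \<open>
  If some closed ball of radius \<open>r\<close> contains none of the \<open>N\<close> random points, its centre certifies
  that the covering radius is at least \<open>r\<close>. It therefore suffices to find many disjoint balls of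
  radius \<open>r\<close>, each of small measure, and to show that with high probability one of them is empty:
  a coupon collector problem.

  The balls are found greedily in \<open>X1\<close>. Each ball of radius \<open>2 * r\<close> about a point of \<open>X1\<close> has
  measure at most \<open>\<Phi> (2 * r) \<le> C2 * \<Phi> r\<close>, so as long as
  fewer than \<open>\<mu>(X1) / (C2 * \<Phi> r)\<close> points have been chosen, these balls do not cover \<open>X1\<close> and another
  point of \<open>X1\<close> has distance more than \<open>2 * r\<close> from all of them (\<open>ex_separated_set\<close>). This yields
  \<open>n \<ge> \<mu>(X1) / (C2 * \<Phi> r)\<close> disjoint balls of radius \<open>r\<close>, each of normalized measure at most
  \<open>p = \<Phi> r / \<mu>(X)\<close>.

  The emptiness of two disjoint balls is negatively correlated, because
  \<open>1 - a - b \<le> (1 - a) * (1 - b)\<close>. Hence the variance of the number of empty balls is at most its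
  mean, which is at least \<open>n * (1 - p) ^ N\<close>, and Chebyshev's inequality bounds the probability that
  every ball is hit by \<open>1 / (n * (1 - p) ^ N)\<close> (\<open>prob_all_hit_le\<close>).

  Now choose \<open>r\<close> with \<open>\<Phi> r = (\<mu>(X) / 2) * ln N / N\<close>. Then \<open>(1 - p) ^ N\<close> is of order
  \<open>1 / sqrt N\<close> while \<open>n\<close> is at least of order \<open>N / ln N\<close>, so the mean tends to infinity. This
  one choice gives both conclusions: subtracting \<open>ln (ln N)\<close> in the argument of the inverse of
  \<open>\<Phi>\<close> only decreases the threshold, and for large \<open>N\<close> the expectation is at least half
  of a threshold that is reached with probability at least \<open>1 / 2\<close>.

  The event \<open>covering radius \<ge> r\<close> need not be measurable, but it contains the measurable event
  that one of finitely many balls is empty, which bounds both the inner probability and the lower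
  integral.
\<close>

section \<open>Second moment method\<close>

text \<open>
  The second moment method for the number \<open>Z\<close> of events that occur: negative correlation removes the
  off-diagonal part of the variance, leaving \<open>Var Z \<le> E Z\<close>, so that
  \<open>P(Z = 0) \<le> Var Z / (E Z)\<^sup>2 \<le> 1 / E Z\<close>. The product form covers \<open>E Z = 0\<close> as well.
\<close>
lemma (in prob_space) prob_no_event_le_inverse_expected_number:
  assumes fin: "finite J" and meas: "\<And>j. j \<in> J \<Longrightarrow> F j \<in> events"
    and neg: "\<And>i j. i \<in> J \<Longrightarrow> j \<in> J \<Longrightarrow> i \<noteq> j \<Longrightarrow> prob (F i \<inter> F j) \<le> prob (F i) * prob (F j)"
  shows "(\<Sum>j\<in>J. prob (F j)) * prob (space M - (\<Union>j\<in>J. F j)) \<le> 1"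
proof -
  define Z where "Z = (\<lambda>x. \<Sum>j\<in>J. indicator (F j) x :: real)"
  define e where "e = (\<Sum>j\<in>J. prob (F j))"
  have Z_sq: "(Z x)\<^sup>2 = (\<Sum>i\<in>J. \<Sum>j\<in>J. indicator (F i \<inter> F j) x)" for x
    by (simp add: Z_def power2_eq_square sum_product indicator_inter_arith)
  have int_Z: "integrable M Z"
    unfolding Z_def using meas by (intro Bochner_Integration.integrable_sum) (auto simp: emeasure_eq_measure)
  have int_Z_sq: "integrable M (\<lambda>x. (Z x)\<^sup>2)"
    unfolding Z_sq using meas
    by (intro Bochner_Integration.integrable_sum) (auto simp: emeasure_eq_measure)
  have EZ: "expectation Z = e"
    unfolding Z_def e_def using meas
    by (subst Bochner_Integration.integral_sum) (auto simp: emeasure_eq_measure)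
  have "expectation (\<lambda>x. (Z x)\<^sup>2) = (\<Sum>i\<in>J. \<Sum>j\<in>J. prob (F i \<inter> F j))"
    unfolding Z_sq using meas
    by (subst Bochner_Integration.integral_sum)
      (auto simp: emeasure_eq_measure Bochner_Integration.integral_sum sets.Int
        intro!: Bochner_Integration.integrable_sum sum.cong)
  also have "\<dots> \<le> (\<Sum>i\<in>J. \<Sum>j\<in>J. prob (F i) * prob (F j) + (if i = j then prob (F i) else 0))"
    using neg by (intro sum_mono) auto
  also have "\<dots> = e\<^sup>2 + e"
    using fin by (simp add: sum.distrib e_def power2_eq_square sum_product)
  finally have var: "variance Z \<le> e"
    using variance_eq[OF int_Z int_Z_sq] EZ by simp
  show ?thesis
  proof (cases "e > 0")
    case True
    have "prob (space M - (\<Union>j\<in>J. F j)) \<le> prob {x \<in> space M. \<bar>Z x - expectation Z\<bar> \<ge> e}"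
    proof (rule finite_measure_mono)
      show "space M - (\<Union>j\<in>J. F j) \<subseteq> {x \<in> space M. \<bar>Z x - expectation Z\<bar> \<ge> e}"
        unfolding EZ using True by (auto simp: Z_def)
      show "{x \<in> space M. \<bar>Z x - expectation Z\<bar> \<ge> e} \<in> events"
        using borel_measurable_integrable[OF int_Z] by measurable
    qed
    also have "\<dots> \<le> variance Z / e\<^sup>2"
      by (rule Chebyshev_inequality) (use int_Z int_Z_sq True in auto)
    also have "\<dots> \<le> e / e\<^sup>2"
      by (rule divide_right_mono[OF var]) simp
    finally show ?thesis
      using True by (simp add: e_def[symmetric] power2_eq_square field_simps)
  next
    case False
    moreover have "e \<ge> 0" by (simp add: e_def sum_nonneg)
    ultimately show ?thesis by (simp add: e_def[symmetric])
  qed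
qed

text \<open>
  The tail of the coupon collector problem. The event that no sample point lies in \<open>A j\<close> is the
  product set of the complements of \<open>A j\<close>, with probability \<open>(1 - P(A j)) ^ N\<close>; disjointness
  of the \<open>A j\<close> makes these events negatively correlated.
\<close>
lemma prob_all_hit_le:
  assumes "prob_space P" and fin: "finite J" and meas: "\<And>j. j \<in> J \<Longrightarrow> A j \<in> sets P"
    and disj: "disjoint_family_on A J"
    and le: "\<And>j. j \<in> J \<Longrightarrow> measure P (A j) \<le> p" and "p \<le> 1"
  shows "real (card J) * (1 - p) ^ N *
    measure (PiM {1..N} (\<lambda>_. P))
      (space (PiM {1..N} (\<lambda>_. P)) - (\<Union>j\<in>J. PiE {1..N} (\<lambda>_. space P - A j))) \<le> 1"
proof -
  interpret P: prob_space P by fact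
  let ?Q = "PiM {1..N} (\<lambda>_. P)"
  interpret Q: finite_product_prob_space "\<lambda>_::nat. P" "{1..N}"
    by unfold_locales auto
  have power: "measure ?Q (PiE {1..N} (\<lambda>_. B)) = measure P B ^ N" if "B \<in> sets P" for B
    using Q.prob_times[of "\<lambda>_. B"] that by simp
  define F where "F j = PiE {1..N} (\<lambda>_. space P - A j)" for j
  have prob_F: "measure ?Q (F j) = (1 - measure P (A j)) ^ N" if "j \<in> J" for j
    using that meas by (simp add: F_def power P.prob_compl del: One_nat_def)
  have "measure ?Q (F i \<inter> F j) \<le> measure ?Q (F i) * measure ?Q (F j)"
    if ij: "i \<in> J" "j \<in> J" "i \<noteq> j" for i j
  proof -
    have disj_ij: "A i \<inter> A j = {}" using disj ij by (auto simp: disjoint_family_on_def)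
    have union: "measure P (A i \<union> A j) = measure P (A i) + measure P (A j)"
      using P.finite_measure_Union[OF meas meas disj_ij] ij by simp
    have "F i \<inter> F j = PiE {1..N} (\<lambda>_. space P - (A i \<union> A j))"
      by (auto simp: F_def PiE_iff)
    then have "measure ?Q (F i \<inter> F j) = (1 - measure P (A i \<union> A j)) ^ N"
      using meas ij by (simp add: power P.prob_compl del: One_nat_def)
    also have "\<dots> \<le> ((1 - measure P (A i)) * (1 - measure P (A j))) ^ N"
      using P.prob_le_1[of "A i \<union> A j"] unfolding union
      by (intro power_mono) (auto simp: algebra_simps)
    finally show ?thesis using ij by (simp add: prob_F power_mult_distrib del: One_nat_def)
  qed
  then have *: "(\<Sum>j\<in>J. measure ?Q (F j)) * measure ?Q (space ?Q - (\<Union>j\<in>J. F j)) \<le> 1"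
    using fin meas
    by (intro Q.prob_no_event_le_inverse_expected_number) (auto simp: F_def intro!: sets_PiM_I_finite)
  have "real (card J) * (1 - p) ^ N \<le> (\<Sum>j\<in>J. measure ?Q (F j))"
    using le \<open>p \<le> 1\<close> by (intro sum_bounded_below) (auto simp: prob_F simp del: One_nat_def intro!: power_mono)
  then have "real (card J) * (1 - p) ^ N * measure ?Q (space ?Q - (\<Union>j\<in>J. F j))
      \<le> (\<Sum>j\<in>J. measure ?Q (F j)) * measure ?Q (space ?Q - (\<Union>j\<in>J. F j))"
    by (rule mult_right_mono) simp
  with * show ?thesis unfolding F_def by linarith
qed

section \<open>Separated sets and empty balls\<close>

text \<open>
  A greedy choice: while \<open>k * b < \<mu>(X)\<close>, the \<open>s\<close>-balls about \<open>k\<close> points cannot cover \<open>X\<close>. The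
  \<open>b\<close> on the right of the size condition accounts for the last point, which is added when the
  previous \<open>n - 1\<close> balls still fail to cover.
\<close>
lemma ex_separated_set:
  fixes \<mu> :: "'a::metric_space measure"
  assumes borel: "sets \<mu> = sets borel" and "finite_measure \<mu>"
    and X: "X \<in> sets (completion \<mu>)"
    and ball: "\<And>x. x \<in> X \<Longrightarrow> measure \<mu> (cball x s) \<le> b" and "0 \<le> b" and "0 \<le> s"
    and "real n * b < measure (completion \<mu>) X + b"
  shows "\<exists>S\<subseteq>X. finite S \<and> card S = n \<and> (\<forall>x\<in>S. \<forall>y\<in>S. x \<noteq> y \<longrightarrow> s < dist x y)"
  using assms(7)
proof (induction n)
  case 0
  then show ?case by (intro exI[of _ "{}"]) auto
next
  case (Suc n)
  interpret finite_measure \<mu> by fact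
  have size: "real n * b < measure (completion \<mu>) X"
    using Suc.prems by (simp add: algebra_simps)
  with Suc.IH \<open>0 \<le> b\<close> obtain S where S: "S \<subseteq> X" "finite S" "card S = n"
    "\<And>x y. x \<in> S \<Longrightarrow> y \<in> S \<Longrightarrow> x \<noteq> y \<Longrightarrow> s < dist x y"
    by force
  have balls: "cball x s \<in> sets \<mu>" for x
    by (simp add: borel)
  have "\<not> X \<subseteq> (\<Union>x\<in>S. cball x s)"
  proof
    assume cover: "X \<subseteq> (\<Union>x\<in>S. cball x s)"
    have U: "(\<Union>x\<in>S. cball x s) \<in> sets \<mu>"
      using S(2) balls by auto
    have "emeasure (completion \<mu>) X \<le> emeasure (completion \<mu>) (\<Union>x\<in>S. cball x s)"
      by (rule emeasure_mono[OF cover]) (rule sets_completionI_sets[OF U])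
    also have "\<dots> = ennreal (measure \<mu> (\<Union>x\<in>S. cball x s))"
      using U by (simp add: emeasure_eq_measure)
    finally have "measure (completion \<mu>) X \<le> measure \<mu> (\<Union>x\<in>S. cball x s)"
      by (simp add: measure_def enn2real_leI del: emeasure_completion)
    also have "\<dots> \<le> (\<Sum>x\<in>S. measure \<mu> (cball x s))"
      using S(2) balls by (intro finite_measure_subadditive_finite) auto
    also have "\<dots> \<le> real n * b"
      using S ball by (intro sum_bounded_above[THEN order_trans]) auto
    finally show False using size by simp
  qed
  then obtain x where x: "x \<in> X" "\<And>y. y \<in> S \<Longrightarrow> s < dist y x"
    by (auto simp: subset_iff not_le)
  have "x \<notin> S"
    using x(2)[of x] \<open>0 \<le> s\<close> by auto
  then show ?case
    using S x by (intro exI[of _ "insert x S"]) (auto simp: dist_commute)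
qed

lemma prob_space_normalized:
  assumes "finite_measure \<mu>" and "measure \<mu> (space \<mu>) > 0"
  shows "prob_space (normalized \<mu>)"
    and "measure (normalized \<mu>) A = measure \<mu> A / measure \<mu> (space \<mu>)"
proof -
  interpret finite_measure \<mu> by fact
  have "1 / emeasure \<mu> (space \<mu>) = ennreal (1 / measure \<mu> (space \<mu>))"
    using assms(2) divide_ennreal[of 1 "measure \<mu> (space \<mu>)"] by (simp add: emeasure_eq_measure)
  then have eq: "normalized \<mu> = scale_measure (ennreal (1 / measure \<mu> (space \<mu>))) \<mu>"
    by (simp add: normalized_def)
  show "prob_space (normalized \<mu>)"
    using assms(2) by (intro prob_spaceI)
      (simp add: eq space_scale_measure emeasure_eq_measure ennreal_mult[symmetric] flip: ennreal_1)
  show "measure (normalized \<mu>) A = measure \<mu> A / measure \<mu> (space \<mu>)"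
    unfolding eq by (subst measure_scale_measure) auto
qed

lemma prob_space_random_points:
  assumes "finite_measure \<mu>" and "measure \<mu> (space \<mu>) > 0"
  shows "prob_space (random_points \<mu> N)"
  unfolding random_points_def using prob_space_normalized(1)[OF assms] by (intro prob_space_PiM)

lemma covering_radius_ge:
  assumes "\<And>x. x \<in> A \<Longrightarrow> r \<le> dist y x" and "y \<in> X"
  shows "ennreal r \<le> covering_radius A X"
  unfolding covering_radius_def using assms
  by (intro SUP_upper2[of y] INF_greatest) (auto intro: ennreal_leI)

text \<open>
  The estimate at a fixed radius: \<open>a\<close> stands for \<open>\<Phi> r\<close> and \<open>C\<close> for the doubling constant.
  The witness \<open>E\<close> is the event that one of the balls about a \<open>2 * r\<close>-separated set is empty.
\<close>
lemma covering_radius_ge_with_prob: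
  fixes \<mu> :: "'a::metric_space measure"
  assumes borel: "sets \<mu> = sets borel" and fin: "finite_measure \<mu>"
    and X: "X \<in> sets (completion \<mu>)" and pos: "measure (completion \<mu>) X > 0"
    and ball: "\<And>x. x \<in> X \<Longrightarrow> measure \<mu> (cball x r) \<le> a"
    and ball2: "\<And>x. x \<in> X \<Longrightarrow> measure \<mu> (cball x (2 * r)) \<le> C * a"
    and "0 < r" "0 < a" "0 < C" and a: "a < measure \<mu> (space \<mu>)"
  shows "\<exists>E\<in>sets (random_points \<mu> N).
    E \<subseteq> {\<omega> \<in> space (random_points \<mu> N). ennreal r \<le> covering_radius (\<omega> ` {1..N}) UNIV} \<and>
    1 - C * a / (measure (completion \<mu>) X * (1 - a / measure \<mu> (space \<mu>)) ^ N)
      \<le> measure (random_points \<mu> N) E"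
proof -
  define m where "m = measure (completion \<mu>) X"
  define p where "p = a / measure \<mu> (space \<mu>)"
  have M: "measure \<mu> (space \<mu>) > 0" using a \<open>0 < a\<close> by linarith
  have p: "p < 1" using a M by (simp add: p_def)
  have Ca: "C * a > 0" using \<open>0 < a\<close> \<open>0 < C\<close> by simp
  define n where "n = nat \<lceil>m / (C * a)\<rceil>"
  have n: "m / (C * a) \<le> real n" "real n < m / (C * a) + 1"
    using pos Ca unfolding n_def m_def by (auto simp: of_nat_ceiling) linarith
  have "real n * (C * a) < m + C * a"
    using mult_strict_right_mono[OF n(2) Ca] \<open>0 < a\<close> \<open>0 < C\<close>
    by (simp add: distrib_right)
  then obtain S where S: "S \<subseteq> X" "finite S" "card S = n"
    "\<And>x y. x \<in> S \<Longrightarrow> y \<in> S \<Longrightarrow> x \<noteq> y \<Longrightarrow> 2 * r < dist x y"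
    using ex_separated_set[OF borel fin X ball2, of n] Ca \<open>0 < r\<close> by (force simp: m_def)
  let ?P = "normalized \<mu>"
  let ?Q = "random_points \<mu> N"
  have sets_P: "sets ?P = sets borel" by (simp add: normalized_def borel)
  interpret Q: prob_space ?Q by (rule prob_space_random_points[OF fin M])
  define E where "E = (\<Union>x\<in>S. PiE {1..N} (\<lambda>_. space ?P - cball x r))"
  have compl: "space ?P - cball x r \<in> sets ?P" for x
    by (intro sets.compl_sets) (simp add: sets_P)
  have E: "E \<in> sets ?Q"
    unfolding E_def random_points_def
    by (intro sets.finite_UN sets_PiM_I_finite finite_atLeastAtMost S(2) compl)
  have "disjoint_family_on (\<lambda>x. cball x r) S"
    unfolding disjoint_family_on_def
  proof (intro ballI impI)
    fix x y assume "x \<in> S" "y \<in> S" "x \<noteq> y"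
    then have "2 * r < dist x y" by (rule S(4))
    then show "cball x r \<inter> cball y r = {}"
      by (intro disjoint_cballI) simp
  qed
  then have "real (card S) * (1 - p) ^ N * measure ?Q (space ?Q - E) \<le> 1"
    unfolding E_def random_points_def using S M p ball sets_P
    by (intro prob_all_hit_le prob_space_normalized(1) fin)
      (auto simp: prob_space_normalized(2)[OF fin M] p_def intro!: divide_right_mono)
  then have hit: "real n * (1 - p) ^ N * (1 - measure ?Q E) \<le> 1"
    using E S(3) by (simp add: Q.prob_compl)
  have "m / (C * a) * (1 - p) ^ N * (1 - measure ?Q E) \<le> real n * (1 - p) ^ N * (1 - measure ?Q E)"
    using n(1) p by (intro mult_right_mono) auto
  with hit have "m / (C * a) * (1 - p) ^ N * (1 - measure ?Q E) \<le> 1" by linarith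
  then have "m * (1 - p) ^ N * (1 - measure ?Q E) \<le> C * a"
    using Ca by (simp add: field_simps)
  moreover have "m * (1 - p) ^ N > 0" using pos p by (simp add: m_def)
  ultimately have "1 - measure ?Q E \<le> C * a / (m * (1 - p) ^ N)"
    by (simp add: pos_le_divide_eq mult.commute)
  moreover have "E \<subseteq> {\<omega> \<in> space ?Q. ennreal r \<le> covering_radius (\<omega> ` {1..N}) UNIV}"
  proof
    fix \<omega> assume "\<omega> \<in> E"
    then obtain x where x: "x \<in> S" "\<omega> \<in> PiE {1..N} (\<lambda>_. space ?P - cball x r)"
      by (auto simp: E_def)
    have "ennreal r \<le> covering_radius (\<omega> ` {1..N}) UNIV"
      using x(2) by (intro covering_radius_ge[of _ _ x]) (auto simp: PiE_iff not_le less_imp_le)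
    then show "\<omega> \<in> {\<omega> \<in> space ?Q. ennreal r \<le> covering_radius (\<omega> ` {1..N}) UNIV}"
      using sets.sets_into_space[OF E] \<open>\<omega> \<in> E\<close> by auto
  qed
  ultimately show ?thesis
    using E by (intro bexI[of _ E]) (auto simp: m_def p_def)
qed

section \<open>Inner probability and inverse of the gauge function\<close>

lemma inner_prob_bounds:
  assumes "prob_space M"
  shows "inner_prob M A \<le> 1"
    and "E \<in> sets M \<Longrightarrow> E \<subseteq> A \<Longrightarrow> measure M E \<le> inner_prob M A"
proof -
  interpret prob_space M by fact
  show "inner_prob M A \<le> 1"
    unfolding inner_prob_def by (rule cSUP_least) (auto intro: exI[of _ "{}"])
  show "measure M E \<le> inner_prob M A" if "E \<in> sets M" "E \<subseteq> A"
    unfolding inner_prob_def using that by (intro cSUP_upper bdd_aboveI[of _ 1]) auto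
qed

text \<open>
  Near \<open>0\<close> every positive value is attained, by the intermediate value theorem, and at a point that
  tends to \<open>0\<close>. Outside the range of \<open>\<Phi>\<close> the term \<open>inv_into {0<..} \<Phi> t\<close> is an arbitrary element,
  so this is what gives it a meaning for large \<open>N\<close>.
\<close>
lemma eventually_inv_into_small:
  fixes \<Phi> :: "real \<Rightarrow> real"
  assumes cont: "continuous_on {0<..} \<Phi>" and nonneg: "\<And>r. r > 0 \<Longrightarrow> \<Phi> r \<ge> 0"
    and mono: "strict_mono_on {0<..} \<Phi>" and lim: "(\<Phi> \<longlongrightarrow> 0) (at_right 0)" and "\<epsilon> > 0"
  shows "\<forall>\<^sub>F t in at_right 0. t \<in> \<Phi> ` {0<..} \<and> inv_into {0<..} \<Phi> t < \<epsilon>"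
proof -
  have "\<Phi> \<epsilon> > 0"
    using nonneg[of "\<epsilon> / 2"] strict_mono_onD[OF mono, of "\<epsilon> / 2" \<epsilon>] \<open>\<epsilon> > 0\<close> by simp
  moreover have "t \<in> \<Phi> ` {0<..} \<and> inv_into {0<..} \<Phi> t < \<epsilon>" if t: "0 < t" "t < \<Phi> \<epsilon>" for t
  proof -
    have "\<forall>\<^sub>F s in at_right 0. \<Phi> s < t \<and> s \<in> {0<..<\<epsilon>}"
      using order_tendstoD(2)[OF lim t(1)] eventually_at_right_real[OF \<open>\<epsilon> > 0\<close>]
      by eventually_elim auto
    then obtain s where s: "\<Phi> s < t" "0 < s" "s < \<epsilon>"
      using eventually_happens'[OF trivial_limit_at_right_real] by auto
    obtain r where r: "s \<le> r" "r \<le> \<epsilon>" "\<Phi> r = t"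
      using IVT'[of \<Phi> s t \<epsilon>] s t continuous_on_subset[OF cont, of "{s..\<epsilon>}"] by force
    have "r < \<epsilon>" using r t(2) by (cases "r = \<epsilon>") auto
    moreover have "inv_into {0<..} \<Phi> t = r"
      using strict_mono_on_imp_inj_on[OF mono] r s by (intro inv_into_f_eq) auto
    moreover have "t \<in> \<Phi> ` {0<..}" using r s by (intro image_eqI[of _ _ r]) auto
    ultimately show ?thesis by simp
  qed
  ultimately show ?thesis
    unfolding eventually_at_right_field by blast
qed

section \<open>The logarithmic lower bound\<close>

text \<open>
  Since \<open>(1 - ln N / (2 * N)) ^ N\<close> is asymptotically \<open>1 / sqrt N\<close>, the quotient is of order
  \<open>ln N / sqrt N\<close>. Any factor below \<open>1\<close> in place of \<open>1 / 2\<close> would do; with the factor \<open>1\<close> the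
  quotient would grow like \<open>ln N\<close>.
\<close>
lemma coupon_collector_limit:
  "(\<lambda>N::nat. K * (ln (real N) / real N) / (m * (1 - ln (real N) / real N / 2) ^ N)) \<longlonglongrightarrow> 0"
proof -
  have "(\<lambda>N::nat. (ln (real N) / real N) / (1 - ln (real N) / real N / 2) ^ N) \<longlonglongrightarrow> 0"
    by real_asymp
  then have "(\<lambda>N::nat. K / m * ((ln (real N) / real N) / (1 - ln (real N) / real N / 2) ^ N)) \<longlonglongrightarrow> K / m * 0"
    by (rule tendsto_mult_left)
  then show ?thesis by (simp add: mult_ac)
qed

lemma measure_completion_le_space:
  assumes "finite_measure \<mu>"
  shows "measure (completion \<mu>) A \<le> measure \<mu> (space \<mu>)"
proof -
  interpret finite_measure \<mu> by fact
  have "emeasure (completion \<mu>) A \<le> ennreal (measure \<mu> (space \<mu>))"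
    using emeasure_space[of "completion \<mu>" A] by (simp add: emeasure_eq_measure)
  then show ?thesis by (simp add: measure_def enn2real_leI)
qed

theorem theorem2p2:
  fixes \<mu> :: "'a::metric_space measure"
    and \<Phi> :: "real \<Rightarrow> real"
    and X1 :: "'a set"
    and C1 C2 r0 c :: real
  assumes "sets \<mu> = sets borel" and "finite_measure \<mu>"
    and "continuous_on {0<..} \<Phi>"
    and "\<And>r. r > 0 \<Longrightarrow> \<Phi> r \<ge> 0"
    and "strict_mono_on {0<..} \<Phi>"
    and "(\<Phi> \<longlongrightarrow> 0) (at_right 0)"
    and "C1 > 1" and "C2 > 1"
    and "\<forall>\<^sub>F r in at_right 0. C1 * \<Phi> r \<le> \<Phi> (2 * r) \<and> \<Phi> (2 * r) \<le> C2 * \<Phi> r"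
    and "X1 \<in> sets (completion \<mu>)" and "measure (completion \<mu>) X1 > 0"
    and "r0 > 0" and "c > 0"
    and "\<And>x r. \<lbrakk>x \<in> X1; 0 < r; r < r0\<rbrakk> \<Longrightarrow>
           c * \<Phi> r \<le> measure \<mu> (cball x r) \<and> measure \<mu> (cball x r) \<le> \<Phi> r"
  shows "(\<exists>c1>0. \<exists>c2>0. \<exists>c3>0.
            (\<lambda>N::nat. inner_prob (random_points \<mu> N)
               {\<omega> \<in> space (random_points \<mu> N).
                  covering_radius (\<omega> ` {1..N}) UNIV \<ge>
                  ennreal (c1 * inv_into {0<..} \<Phi>
                    ((c2 * ln (real N) - c3 * ln (ln (real N))) / real N))})
            \<longlonglongrightarrow> 1)
       \<and> (\<exists>c1>0. \<exists>c2>0. \<forall>\<^sub>F N::nat in sequentially.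
            (\<integral>\<^sup>+ \<omega>. covering_radius (\<omega> ` {1..N}) UNIV \<partial>random_points \<mu> N) \<ge>
            ennreal (c1 * inv_into {0<..} \<Phi> (c2 * (ln (real N) / real N))))"
proof -
  interpret finite_measure \<mu> by fact
  define m where "m = measure (completion \<mu>) X1"
  define M where "M = measure \<mu> (space \<mu>)"
  have "m > 0" using assms(11) by (simp add: m_def)
  have "M > 0"
    using measure_completion_le_space[OF assms(2), of X1] \<open>m > 0\<close> by (simp add: m_def M_def)
  define inv\<Phi> where "inv\<Phi> = inv_into {0<..} \<Phi>"
  \<comment> \<open>The argument of the inverse of \<open>\<Phi>\<close> for the expectation; \<open>t\<close> is the one for the probability,
    with \<open>c2 = M / 2\<close> and \<open>c3 = 1\<close>.\<close>
  define u where "u N = M / 2 * (ln (real N) / real N)" for N :: nat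
  define t where "t N = (M / 2 * ln (real N) - 1 * ln (ln (real N))) / real N" for N :: nat
  \<comment> \<open>The lower bound for the probability at the radius \<open>r\<close> with \<open>\<Phi> r = u N\<close>.\<close>
  define B where "B N = 1 - C2 * (M / 2) * (ln (real N) / real N) / (m * (1 - ln (real N) / real N / 2) ^ N)"
    for N :: nat
  let ?Q = "random_points \<mu>"
  let ?G = "\<lambda>N s. {\<omega> \<in> space (?Q N). ennreal s \<le> covering_radius (\<omega> ` {1..N}) UNIV}"
  have Q: "prob_space (?Q N)" for N
    using prob_space_random_points[OF assms(2)] \<open>M > 0\<close> by (simp add: M_def)
  have B: "B \<longlonglongrightarrow> 1"
    unfolding B_def using tendsto_diff[OF tendsto_const coupon_collector_limit, of 1] by (simp only: diff_zero)
  obtain d where d: "d > 0" "\<And>r. 0 < r \<Longrightarrow> r < d \<Longrightarrow> \<Phi> (2 * r) \<le> C2 * \<Phi> r"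
    using assms(9) unfolding eventually_at_right_field by auto
  \<comment> \<open>Radii below \<open>\<epsilon>\<close> admit both the doubling bound at \<open>r\<close> and the ball bound at \<open>2 * r\<close>.\<close>
  define \<epsilon> where "\<epsilon> = min d (r0 / 2)"
  have "\<epsilon> > 0" using d(1) assms(12) by (simp add: \<epsilon>_def)
  have \<Phi>_pos: "\<Phi> r > 0" if "r > 0" for r
    using assms(4)[of "r / 2"] strict_mono_onD[OF assms(5), of "r / 2" r] that by simp
  have small: "\<forall>\<^sub>F s in at_right 0. s \<in> \<Phi> ` {0<..} \<and> inv\<Phi> s < \<epsilon>"
    unfolding inv\<Phi>_def by (rule eventually_inv_into_small[OF assms(3-6) \<open>\<epsilon> > 0\<close>])
  have "filterlim u (at_right 0) sequentially"
    unfolding u_def using \<open>M > 0\<close> by real_asymp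
  note u_small = eventually_compose_filterlim[OF small this]
  have "filterlim t (at_right 0) sequentially"
    unfolding t_def using \<open>M > 0\<close> by real_asymp
  note t_small = eventually_compose_filterlim[OF small this]
  have inv\<Phi>: "inv\<Phi> s > 0" "\<Phi> (inv\<Phi> s) = s" if "s \<in> \<Phi> ` {0<..}" for s
    using inv_into_into[OF that] f_inv_into_f[OF that] by (auto simp: inv\<Phi>_def)
  have main: "\<forall>\<^sub>F N in sequentially. \<exists>E\<in>sets (?Q N). E \<subseteq> ?G N (inv\<Phi> (u N)) \<and> B N \<le> measure (?Q N) E"
  proof -
    have "\<forall>\<^sub>F N in sequentially. u N < M"
      unfolding u_def using \<open>M > 0\<close> by real_asymp
    with u_small show ?thesis
    proof eventually_elim
      case (elim N)
      define r where "r = inv\<Phi> (u N)"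
      have r: "0 < r" "\<Phi> r = u N" "r < d" "2 * r < r0"
        using elim inv\<Phi>[of "u N"] by (auto simp: r_def \<epsilon>_def)
      have "measure \<mu> (cball x r) \<le> u N" if "x \<in> X1" for x
        using assms(14)[OF that, of r] r by auto
      moreover have "measure \<mu> (cball x (2 * r)) \<le> C2 * u N" if "x \<in> X1" for x
        using assms(14)[OF that, of "2 * r"] r d(2)[of r] by auto
      moreover have "u N > 0" using \<Phi>_pos[OF r(1)] r by simp
      ultimately have "\<exists>E\<in>sets (?Q N). E \<subseteq> ?G N r \<and>
          1 - C2 * u N / (m * (1 - u N / M) ^ N) \<le> measure (?Q N) E"
        unfolding m_def M_def using assms r elim
        by (intro covering_radius_ge_with_prob) (auto simp: M_def)
      moreover have "u N / M = ln (real N) / real N / 2"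
        using \<open>M > 0\<close> by (simp add: u_def)
      moreover have "C2 * u N = C2 * (M / 2) * (ln (real N) / real N)"
        by (simp add: u_def)
      ultimately show ?case by (simp only: B_def r_def)
    qed
  qed
  have first: "(\<lambda>N. inner_prob (?Q N) (?G N (1 * inv\<Phi> (t N)))) \<longlonglongrightarrow> 1"
  proof (rule tendsto_sandwich[OF _ _ B tendsto_const])
    show "\<forall>\<^sub>F N in sequentially. inner_prob (?Q N) (?G N (1 * inv\<Phi> (t N))) \<le> 1"
      using inner_prob_bounds(1)[OF Q] by simp
    have "\<forall>\<^sub>F N in sequentially. t N \<le> u N"
      unfolding t_def u_def by real_asymp
    with main u_small t_small
    show "\<forall>\<^sub>F N in sequentially. B N \<le> inner_prob (?Q N) (?G N (1 * inv\<Phi> (t N)))"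
    proof eventually_elim
      case (elim N)
      then obtain E where E: "E \<in> sets (?Q N)" "E \<subseteq> ?G N (inv\<Phi> (u N))" "B N \<le> measure (?Q N) E"
        by auto
      have "\<not> inv\<Phi> (u N) < inv\<Phi> (t N)"
        using strict_mono_onD[OF assms(5), of "inv\<Phi> (u N)" "inv\<Phi> (t N)"] inv\<Phi>[of "u N"] inv\<Phi>[of "t N"] elim
        by auto
      then have "ennreal (inv\<Phi> (t N)) \<le> ennreal (inv\<Phi> (u N))"
        by (intro ennreal_leI) simp
      then have "?G N (inv\<Phi> (u N)) \<subseteq> ?G N (1 * inv\<Phi> (t N))"
        unfolding mult_1 by (intro Collect_mono) (blast intro: order_trans)
      with E(2) have "E \<subseteq> ?G N (1 * inv\<Phi> (t N))"
        by (rule subset_trans)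
      then have "measure (?Q N) E \<le> inner_prob (?Q N) (?G N (1 * inv\<Phi> (t N)))"
        by (rule inner_prob_bounds(2)[OF Q E(1)])
      with E(3) show ?case by (rule order_trans)
    qed
  qed
  have second: "\<forall>\<^sub>F N in sequentially.
      ennreal (1 / 2 * inv\<Phi> (u N)) \<le> (\<integral>\<^sup>+ \<omega>. covering_radius (\<omega> ` {1..N}) UNIV \<partial>?Q N)"
  proof -
    have "\<forall>\<^sub>F N in sequentially. B N > 1 / 2"
      by (rule order_tendstoD(1)[OF B]) simp
    with main u_small show ?thesis
    proof eventually_elim
      case (elim N)
      then obtain E where E: "E \<in> sets (?Q N)" "E \<subseteq> ?G N (inv\<Phi> (u N))" "B N \<le> measure (?Q N) E"
        by auto
      interpret Q: prob_space "?Q N" by (rule Q)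
      have pos: "inv\<Phi> (u N) > 0" using inv\<Phi>[of "u N"] elim by auto
      have "ennreal (1 / 2 * inv\<Phi> (u N)) \<le> ennreal (inv\<Phi> (u N) * measure (?Q N) E)"
        using E(3) elim pos by (intro ennreal_leI) (simp add: field_simps)
      also have "\<dots> = (\<integral>\<^sup>+ \<omega>. ennreal (inv\<Phi> (u N)) * indicator E \<omega> \<partial>?Q N)"
        using E(1) pos by (simp add: nn_integral_cmult_indicator Q.emeasure_eq_measure ennreal_mult)
      also have "\<dots> \<le> (\<integral>\<^sup>+ \<omega>. covering_radius (\<omega> ` {1..N}) UNIV \<partial>?Q N)"
        using E(2) by (intro nn_integral_mono) (auto simp: indicator_def)
      finally show ?case .
    qed
  qed
  show ?thesis
  proof (rule conjI)
    show "\<exists>c1>0. \<exists>c2>0. \<exists>c3>0. (\<lambda>N::nat. inner_prob (?Q N)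
        (?G N (c1 * inv_into {0<..} \<Phi> ((c2 * ln (real N) - c3 * ln (ln (real N))) / real N)))) \<longlonglongrightarrow> 1"
      using first \<open>M > 0\<close> unfolding t_def inv\<Phi>_def
      by (intro exI[of _ "1::real"] exI[of _ "M / 2"] conjI) auto
    show "\<exists>c1>0. \<exists>c2>0. \<forall>\<^sub>F N::nat in sequentially.
        (\<integral>\<^sup>+ \<omega>. covering_radius (\<omega> ` {1..N}) UNIV \<partial>?Q N) \<ge>
        ennreal (c1 * inv_into {0<..} \<Phi> (c2 * (ln (real N) / real N)))"
      using second \<open>M > 0\<close> unfolding u_def inv\<Phi>_def
      by (intro exI[of _ "1 / 2::real"] exI[of _ "M / 2"] conjI) auto
  qed
qed

end
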